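(* Let $E$ and $F$ be finite dimensional Hermitian vector spaces, $p=\dim E$, and let $*$ be the partial operation on $\mathrm{Gr}_p(E\oplus F)$ defined in the context. If $L_1=\Gamma_A$ and $L_2=\Gamma_B$ are the graphs of $A,B\in\mathrm{Hom}(E,F)$, then $$L_1*L_2=\Gamma_{A+B}.$$
   Context: $\mathrm{Gr}_p(W)$ is the Grassmannian of $p$-dimensional complex subspaces of $W$, $\Gamma_A=\{(v,Av)\mid v\in E\}\subset E\oplus F$. Let $\mathrm{Gr}^+_{p,p}(E\oplus F)$ be the open set of pairs $(L_1,L_2)\in\mathrm{Gr}_p(E\oplus F)\times\mathrm{Gr}_p(E\oplus F)$ with $$\pi^E(L_1)+\pi^E(L_2)=E\quad(\text{equivalently }L_1^\perp\cap L_2^\perp\cap E=\{0\})\qquad\text{and}\qquad L_1\cap L_2\cap F=\{0\},$$ where $\pi^E:E\oplus F\to E$ is the projection; pairs of graphs belong to it. The operation $*:\mathrm{Gr}^+_{p,p}(E\oplus F)\to\mathrm{Gr}_p(E\oplus F)$ is the composition of: (a) $(L_1,L_2)\mapsto V=L_1\oplus L_2\in\mathrm{Gr}_{2p}(G)$, $G=E\oplus F\oplus E\oplus F$; (b) $V\mapsto W=V\cap(\Delta^{E_1}\oplus F_1)$, where $E_1=E\oplus E\subset G$, $F_1=F\oplus F\subset G$ and $\Delta^{E_1}$ is the diagonal of $E_1$; since $\pi^E(L_1)+\pi^E(L_2)=E$, one has $\dim W=p$; (c) $W\mapsto\theta(W)$, where $\theta:\Delta^{E_1}\oplus F_1\to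 E\oplus F$, $\theta(v,w_1,v,w_2)=(v,w_1+w_2)$; since $L_1\cap L_2\cap F=\{0\}$, one has $W\cap\ker\theta=\{0\}$. So $L_1*L_2=\theta\big((L_1\oplus L_2)\cap(\Delta^{E_1}\oplus F_1)\big)$. *)

theory Defs
  imports "HOL-Analysis.Analysis"
begin

text \<open>
  A finite-dimensional complex vector space with a positive definite Hermitian form,
  linear in the first and conjugate-linear in the second argument.
\<close>

locale hermitian_space = vector_space scale
  for scale :: "complex \<Rightarrow> 'a::ab_group_add \<Rightarrow> 'a" +
  fixes herm :: "'a \<Rightarrow> 'a \<Rightarrow> complex"
  assumes finite_dim: "\<exists>B. finite B \<and> span B = UNIV"
    and herm_add_left: "herm (x + y) z = herm x z + herm y z"
    and herm_scale_left: "herm (scale c x) y = c * herm x y"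
    and herm_cnj: "herm y x = cnj (herm x y)"
    and herm_pos: "x \<noteq> 0 \<Longrightarrow> 0 < Re (herm x x)"

definition grassmannian ::
    "(complex \<Rightarrow> 'a::ab_group_add \<Rightarrow> 'a) \<Rightarrow> nat \<Rightarrow> 'a set set"
  where "grassmannian s p = {L. module.subspace s L \<and> vector_space.dim s L = p}"

definition graph :: "('e \<Rightarrow> 'f) \<Rightarrow> ('e \<times> 'f) set"
  where "graph A = {(v, A v) | v. True}"

text \<open>
  The direct sum of \<open>E\<close> and \<open>F\<close> is the product type \<open>'e \<times> 'f\<close> with scalar multiplication
  \<open>module_prod.scale sE sF\<close>; \<open>F\<close> sits in it as \<open>{0} \<times> UNIV\<close>.
\<close>

definition grass_plus ::
    "(complex \<Rightarrow> 'e::ab_group_add \<Rightarrow> 'e) \<Rightarrow> (complex \<Rightarrow> 'f::ab_group_add \<Rightarrow> 'f) \<Rightarrow> nat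
      \<Rightarrow> (('e \<times> 'f) set \<times> ('e \<times> 'f) set) set"
  where "grass_plus sE sF p =
    {(L1, L2). L1 \<in> grassmannian (module_prod.scale sE sF) p
      \<and> L2 \<in> grassmannian (module_prod.scale sE sF) p
      \<and> {x + y | x y. x \<in> fst ` L1 \<and> y \<in> fst ` L2} = UNIV
      \<and> L1 \<inter> L2 \<inter> ({0} \<times> UNIV) = {0}}"

definition dsum :: "('e \<times> 'f) set \<Rightarrow> ('e \<times> 'f) set \<Rightarrow> ('e \<times> 'f \<times> 'e \<times> 'f) set"
  where "dsum L1 L2 = {(v1, w1, v2, w2). (v1, w1) \<in> L1 \<and> (v2, w2) \<in> L2}"

text \<open>The direct sum of the diagonal of \<open>E \<oplus> E\<close> and of \<open>F \<oplus> F\<close>, inside \<open>E \<oplus> F \<oplus> E \<oplus> F\<close>:\<close>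

definition diag_sum :: "('e \<times> 'f \<times> 'e \<times> 'f) set"
  where "diag_sum = {(v, w1, v, w2) | v w1 w2. True}"

text \<open>Only the values of \<open>theta\<close> on \<open>diag_sum\<close> are relevant.\<close>

definition theta :: "'e \<times> 'f::ab_group_add \<times> 'e \<times> 'f \<Rightarrow> 'e \<times> 'f"
  where "theta = (\<lambda>(v, w1, _, w2). (v, w1 + w2))"

text \<open>The value is \<open>None\<close> exactly at the pairs outside the domain \<open>grass_plus sE sF p\<close>.\<close>

definition grass_star ::
    "(complex \<Rightarrow> 'e::ab_group_add \<Rightarrow> 'e) \<Rightarrow> (complex \<Rightarrow> 'f::ab_group_add \<Rightarrow> 'f) \<Rightarrow> nat
      \<Rightarrow> ('e \<times> 'f) set \<times> ('e \<times> 'f) set \<rightharpoonup> ('e \<times> 'f) set"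
  where "grass_star sE sF p = (\<lambda>(L1, L2).
    if (L1, L2) \<in> grass_plus sE sF p
    then Some (theta ` (dsum L1 L2 \<inter> diag_sum))
    else None)"

end

theory Submission
  imports Defs
begin

text \<open>A point of the direct sum of the two graphs lies over the diagonal of \<open>E\<close>
  exactly when it is \<open>(v, A v, v, B v)\<close>, and \<open>theta\<close> sends it to
  \<open>(v, A v + B v)\<close>; this is \<open>theta_graphs\<close>. The rest is that the pair of
  graphs lies in the domain of the operation (\<open>graph_pair_in_grass_plus\<close>). There
  linearity enters: a graph is the image of \<open>E\<close> under the injective linear map sending
  \<open>v\<close> to \<open>(v, A v)\<close>, hence a subspace of dimension
  \<open>p\<close>.\<close>

lemma linear_into_graph:
  assumes "Vector_Spaces.linear sE sF A"
  shows "Vector_Spaces.linear sE (module_prod.scale sE sF) (\<lambda>v. (v, A v))"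
proof -
  interpret A: Vector_Spaces.linear sE sF A by fact
  interpret vector_space_prod sE sF by unfold_locales
  show ?thesis
    by unfold_locales (simp_all add: A.add A.scale scale_def)
qed

lemma graph_eq_image: "graph A = (\<lambda>v. (v, A v)) ` UNIV"
  by (auto simp: graph_def)

text \<open>An injective linear map carries a basis of \<open>V\<close> to an independent set of the
  same cardinality that spans the image.\<close>

lemma dim_image_of_injective_linear:
  assumes "Vector_Spaces.linear s1 s2 f" "inj f"
  shows "vector_space.dim s2 (f ` V) = vector_space.dim s1 V"
proof -
  interpret f: Vector_Spaces.linear s1 s2 f by fact
  obtain B where B: "B \<subseteq> V" "f.vs1.independent B" "V \<subseteq> f.vs1.span B" "card B = f.vs1.dim V"
    by (rule f.vs1.basis_exists)
  have "f.vs2.dim (f ` V) = card (f ` B)"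
  proof (rule f.vs2.basis_card_eq_dim[symmetric])
    show "f ` V \<subseteq> f.vs2.span (f ` B)"
      using B(3) by (auto simp: f.span_image)
    show "f.vs2.independent (f ` B)"
      using B(2) assms(2) by (rule f.independent_inj_image)
  qed (use B(1) in blast)
  with B(4) show ?thesis
    using assms(2) by (simp add: card_image inj_on_subset)
qed

lemma graph_in_grassmannian:
  assumes "Vector_Spaces.linear sE sF A"
  shows "graph A \<in> grassmannian (module_prod.scale sE sF) (vector_space.dim sE UNIV)"
proof -
  interpret g: Vector_Spaces.linear sE "module_prod.scale sE sF" "\<lambda>v. (v, A v)"
    using assms by (rule linear_into_graph)
  have "inj (\<lambda>v. (v, A v))"
    by (simp add: inj_on_def)
  then have "g.vs2.dim (graph A) = g.vs1.dim UNIV"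
    unfolding graph_eq_image by (rule dim_image_of_injective_linear[OF g.linear_axioms])
  moreover have "g.vs2.subspace (graph A)"
    unfolding graph_eq_image by (intro g.subspace_image g.vs1.subspace_UNIV)
  ultimately show ?thesis
    by (simp add: grassmannian_def)
qed

text \<open>Each graph alone already projects onto \<open>E\<close>, and its only point over 0 is
  \<open>(0, A 0) = 0\<close>, so it meets \<open>F\<close> trivially.\<close>

lemma graph_pair_in_grass_plus:
  assumes "Vector_Spaces.linear sE sF A" "Vector_Spaces.linear sE sF B"
  shows "(graph A, graph B) \<in> grass_plus sE sF (vector_space.dim sE UNIV)"
proof -
  interpret A: Vector_Spaces.linear sE sF A by fact
  interpret B: Vector_Spaces.linear sE sF B by fact
  have "fst ` graph C = UNIV" for C :: "'a \<Rightarrow> 'b"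
    by (force simp: graph_def)
  \<comment> \<open>The witness 0 serves as one of the two summands.\<close>
  moreover have "{x + y | x y. x \<in> UNIV \<and> y \<in> UNIV} = (UNIV :: 'a set)"
    by (auto intro: exI[of _ 0])
  moreover have "graph A \<inter> graph B \<inter> ({0} \<times> UNIV) = {0}"
    by (auto simp: graph_def A.zero B.zero zero_prod_def)
  ultimately show ?thesis
    using assms by (simp add: grass_plus_def graph_in_grassmannian)
qed

text \<open>Intersecting with \<open>diag_sum\<close> forces the base points of the two graphs to
  coincide, so \<open>theta\<close> adds the values of \<open>A\<close> and \<open>B\<close> at one
  and the same \<open>v\<close>.\<close>

lemma theta_graphs:
  "theta ` (dsum (graph A) (graph B) \<inter> diag_sum) = graph (\<lambda>v. A v + B v)"
  by (force simp: theta_def dsum_def diag_sum_def graph_def)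

theorem proposition11p3:
  fixes sE :: "complex \<Rightarrow> 'e::ab_group_add \<Rightarrow> 'e"
    and sF :: "complex \<Rightarrow> 'f::ab_group_add \<Rightarrow> 'f"
    and hE :: "'e \<Rightarrow> 'e \<Rightarrow> complex"
    and hF :: "'f \<Rightarrow> 'f \<Rightarrow> complex"
    and A B :: "'e \<Rightarrow> 'f"
    and p :: nat
  assumes "hermitian_space sE hE"
    and "hermitian_space sF hF"
    and "p = vector_space.dim sE (UNIV :: 'e set)"
    and "Vector_Spaces.linear sE sF A"
    and "Vector_Spaces.linear sE sF B"
  shows "grass_star sE sF p (graph A, graph B) = Some (graph (\<lambda>v. A v + B v))"
  \<comment> \<open>Membership in the domain selects the \<open>Some\<close> branch.\<close>
  using assms(3-5) by (simp add: grass_star_def graph_pair_in_grass_plus theta_graphs)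

end
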